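(* Let $p>3$ be a prime. Then $$\sum_{k=0}^{p-1}\frac{\binom{2k}k\binom{3k}{k}}{27^k(2k+1)}\equiv \Big(\frac p3\Big)-4p^2U_{p-3}\pmod{p^3}.$$
   Context: For $x,y\in\mathbb Q$ with denominators prime to $p$, $x\equiv y\pmod{p^m}$ means $(x-y)/p^m$ has denominator prime to $p$. $\big(\frac p3\big)$ is the Legendre symbol. The sequence $\{U_n\}$ is defined by $U_0=1$ and $U_n=-2\sum_{k=1}^{[n/2]}\binom n{2k}U_{n-2k}$ for $n\ge1$. *)

theory Defs
  imports Complex_Main "HOL-Number_Theory.Number_Theory"
begin

definition p_integral :: "nat \<Rightarrow> rat \<Rightarrow> bool" where
  "p_integral p x \<longleftrightarrow> coprime (snd (quotient_of x)) (int p)"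

text \<open>Congruence modulo \<open>p ^ m\<close> is only meaningful between rationals whose denominators are
  prime to \<open>p\<close>; this requirement is part of the relation.\<close>

definition rat_cong :: "nat \<Rightarrow> nat \<Rightarrow> rat \<Rightarrow> rat \<Rightarrow> bool" where
  "rat_cong p m x y \<longleftrightarrow>
     p_integral p x \<and> p_integral p y \<and> p_integral p ((x - y) / of_nat p ^ m)"

function U :: "nat \<Rightarrow> int" where
  "U n = (if n = 0 then 1
          else - 2 * (\<Sum>k = 1..n div 2. int (n choose (2 * k)) * U (n - 2 * k)))"
  by auto
termination
  by (relation "measure id") auto

text \<open>The defining equation is recursive without a constructor pattern, so it would make the
  simplifier loop.\<close>

declare U.simps [simp del]

lemma U_0: "U 0 = 1"
  by (simp add: U.simps)

lemma U_rec:
  "n \<ge> 1 \<Longrightarrow> U n = - 2 * (\<Sum>k = 1..n div 2. int (n choose (2 * k)) * U (n - 2 * k))"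
  by (subst U.simps) simp

end

(*
  Idea.  With T_k(a) = (-a)_k (a+1)_k / k!^2, the k-th term of the sum is T_k(x)/(2k+1) for x = -1/3
  and also for x = -2/3.  Put S(a) = sum_{k<p} T_k(a)/(2k+1) and R(a) = prod_{0<i<p} (1 - a^2/i^2).
  Then (2a+1) S(a) - (2a-1) S(a-1) = 2 R(a), so that (2n+1) S(n) = 1 + 2 sum_{j=1..n} R(j) for
  natural n.  Let w = p mod 3 and choose n = p q + m with m = (p-w)/3 and 3n + w = w p^4.  This n is
  congruent to -w/3 modulo p^4, and one factor p may be lost to the denominator 2k+1.
  Modulo p^3 one has R(pu) = 1 and R(pu+r) = p^2 u(u+1)/r^2 for 0 < r < p, which leaves the sum
  of 1/r^2 over r <= m, that is, of r^(p-3) modulo p.  The polynomials V_n(x) with exponential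
  generating function e^(xt)/(e^t - 1 + e^(-t)) have V_n(0) = U_n and express V_n(x+6) - V_n(x)
  through n-th powers; telescoping up to p and the symmetries s -> p - s and s -> 2s of the power
  sums over residue classes modulo 6 show that this sum is congruent to 3U_{p-3} or -3U_{p-3}.
*)

theory Submission
  imports Defs
begin

section \<open>Congruences between \<open>p\<close>-integral rationals\<close>

text \<open>The reduced denominator divides every other denominator of the same rational. So closure
  under sums and products can be checked on unreduced fractions.\<close>

lemma p_integral_iff:
  assumes "prime p"
  shows "p_integral p x \<longleftrightarrow> (\<exists>a b. \<not> int p dvd b \<and> x = of_int a / of_int b)"
proof
  assume "p_integral p x"
  then have "coprime (snd (quotient_of x)) (int p)" by (simp add: p_integral_def)
  moreover have "prime (int p)" using assms by simp
  ultimately have "\<not> int p dvd snd (quotient_of x)"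
    by (metis coprime_absorb_right not_prime_unit)
  moreover have "x = of_int (fst (quotient_of x)) / of_int (snd (quotient_of x))"
    by (metis prod.collapse quotient_of_div)
  ultimately show "\<exists>a b. \<not> int p dvd b \<and> x = of_int a / of_int b" by blast
next
  assume "\<exists>a b. \<not> int p dvd b \<and> x = of_int a / of_int b"
  then obtain a b where ab: "\<not> int p dvd b" "x = of_int a / of_int b" by blast
  obtain c d where cd: "quotient_of x = (c, d)" by force
  have d: "d > 0" "coprime c d" using cd quotient_of_denom_pos quotient_of_coprime by blast+
  have "x = of_int c / of_int d" using cd by (rule quotient_of_div)
  moreover have "b \<noteq> 0" using ab by auto
  ultimately have "(of_int (a * d) :: rat) = of_int (c * b)"
    using ab d by (simp add: frac_eq_eq)
  then have "a * d = c * b" by (simp only: of_int_eq_iff)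
  then have "d dvd b" using d by (metis coprime_commute coprime_dvd_mult_right_iff dvd_triv_right)
  then have "\<not> int p dvd d" using ab dvd_trans by blast
  then show "p_integral p x" using assms cd
    by (simp add: p_integral_def prime_imp_coprime coprime_commute[of d])
qed

context
  fixes p :: nat
  assumes p: "prime p"
begin

lemma p_integral_divide_int: "\<not> int p dvd b \<Longrightarrow> p_integral p (of_int a / of_int b)"
  using p_integral_iff[OF p] by blast

lemma p_integral_of_int [simp]: "p_integral p (of_int a)"
  using p_integral_divide_int[of 1 a] p by (simp add: prime_nat_iff)

lemma p_integral_of_nat [simp]: "p_integral p (of_nat a)"
  using p_integral_of_int[of "int a"] by simp

lemma p_integral_0 [simp]: "p_integral p 0"
  using p_integral_of_int[of 0] by simp

lemma p_integral_1 [simp]: "p_integral p 1"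
  using p_integral_of_int[of 1] by simp

lemma p_integral_add [intro]:
  assumes "p_integral p x" "p_integral p y"
  shows "p_integral p (x + y)"
proof -
  obtain a b c d where "\<not> int p dvd b" "x = of_int a / of_int b"
      "\<not> int p dvd d" "y = of_int c / of_int d"
    using assms p_integral_iff[OF p] by blast
  moreover from this have "b \<noteq> 0" "d \<noteq> 0" by auto
  moreover have "\<not> int p dvd b * d"
    using calculation p by (simp add: prime_dvd_mult_iff)
  ultimately show ?thesis
    using p_integral_divide_int[of "b * d" "a * d + c * b"] by (simp add: add_frac_eq)
qed

lemma p_integral_mult [intro]:
  assumes "p_integral p x" "p_integral p y"
  shows "p_integral p (x * y)"
proof -
  obtain a b c d where "\<not> int p dvd b" "x = of_int a / of_int b"
      "\<not> int p dvd d" "y = of_int c / of_int d"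
    using assms p_integral_iff[OF p] by blast
  moreover have "\<not> int p dvd b * d"
    using calculation p by (simp add: prime_dvd_mult_iff)
  ultimately show ?thesis
    using p_integral_divide_int[of "b * d" "a * c"] by simp
qed

lemma p_integral_minus [intro]: "p_integral p x \<Longrightarrow> p_integral p (- x)"
  using p_integral_mult[of "-1" x] p_integral_of_int[of "-1"] by simp

lemma p_integral_diff [intro]: "p_integral p x \<Longrightarrow> p_integral p y \<Longrightarrow> p_integral p (x - y)"
  using p_integral_add[of x "- y"] p_integral_minus by simp

lemma p_integral_power [intro]: "p_integral p x \<Longrightarrow> p_integral p (x ^ n)"
  by (induction n) auto

lemma p_integral_sum [intro]: "(\<And>i. i \<in> A \<Longrightarrow> p_integral p (f i)) \<Longrightarrow> p_integral p (sum f A)"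
  by (induction A rule: infinite_finite_induct) auto

lemma p_integral_inverse_int: "\<not> int p dvd b \<Longrightarrow> p_integral p (1 / of_int b)"
  using p_integral_divide_int[of b 1] by simp

lemma p_integral_inverse_nat: "\<not> p dvd b \<Longrightarrow> p_integral p (1 / of_nat b)"
  using p_integral_inverse_int[of "int b"] by simp

lemmas p_integral_intros =
  p_integral_of_int p_integral_of_nat p_integral_0 p_integral_1 p_integral_add p_integral_mult
  p_integral_minus p_integral_diff p_integral_power p_integral_sum

lemma p_neq_0 [simp]: "p \<noteq> 0"
  using p by (simp add: prime_nat_iff)

text \<open>Integrality of \<open>x\<close> comes for free from \<open>y\<close> and the quotient
  \<open>z\<close>, so a congruence amounts to an equation with an integral witness.\<close>

lemma rat_congI:
  assumes "p_integral p y" "p_integral p z" "x - y = of_nat p ^ m * z"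
  shows "rat_cong p m x y"
proof -
  have "x = y + of_nat p ^ m * z" using assms(3) by (simp add: algebra_simps)
  moreover have "p_integral p (y + of_nat p ^ m * z)" by (intro p_integral_intros assms)
  ultimately have "p_integral p x" by simp
  moreover have "(x - y) / of_nat p ^ m = z" using assms(3) by simp
  ultimately show ?thesis using assms by (simp add: rat_cong_def)
qed

lemma rat_congE:
  assumes "rat_cong p m x y"
  obtains z where "p_integral p x" "p_integral p y" "p_integral p z" "x - y = of_nat p ^ m * z"
proof (rule that)
  show "x - y = of_nat p ^ m * ((x - y) / of_nat p ^ m)" by simp
qed (use assms in \<open>simp_all add: rat_cong_def\<close>)

lemma rat_cong_refl: "p_integral p x \<Longrightarrow> rat_cong p m x x"
  by (rule rat_congI[of _ 0]) auto

lemma rat_cong_sym: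
  assumes "rat_cong p m x y"
  shows "rat_cong p m y x"
proof -
  obtain z where "p_integral p x" "p_integral p z" "x - y = of_nat p ^ m * z"
    using assms by (elim rat_congE)
  then show ?thesis
    by (intro rat_congI[of _ "- z"]) (auto simp: p_integral_minus)
qed

lemma rat_cong_trans:
  assumes "rat_cong p m x y" "rat_cong p m y z"
  shows "rat_cong p m x z"
proof -
  obtain s t where "p_integral p s" "p_integral p t" "p_integral p z"
    "x - y = of_nat p ^ m * s" "y - z = of_nat p ^ m * t"
    using assms by (elim rat_congE) blast
  then show ?thesis
    by (intro rat_congI[of _ "s + t"]) (auto simp: distrib_left p_integral_add)
qed

lemma rat_cong_add:
  assumes "rat_cong p m x y" "rat_cong p m x' y'"
  shows "rat_cong p m (x + x') (y + y')"
proof -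
  obtain s t where st: "p_integral p s" "p_integral p t" "p_integral p y" "p_integral p y'"
    "x - y = of_nat p ^ m * s" "x' - y' = of_nat p ^ m * t"
    using assms by (elim rat_congE) blast
  have "x + x' - (y + y') = (x - y) + (x' - y')" by simp
  also have "\<dots> = of_nat p ^ m * (s + t)" unfolding st(5,6) by (simp add: distrib_left)
  finally show ?thesis using st by (intro rat_congI[of _ "s + t"] p_integral_intros)
qed

lemma rat_cong_mult:
  assumes "rat_cong p m x y" "rat_cong p m x' y'"
  shows "rat_cong p m (x * x') (y * y')"
proof -
  obtain s t where st: "p_integral p s" "p_integral p t" "p_integral p y" "p_integral p x'" "p_integral p y'"
    "x - y = of_nat p ^ m * s" "x' - y' = of_nat p ^ m * t"
    using assms by (elim rat_congE) blast
  have "x * x' - y * y' = (x - y) * x' + y * (x' - y')" by (simp add: algebra_simps)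
  also have "\<dots> = of_nat p ^ m * (s * x' + y * t)" unfolding st(6,7) by (simp add: algebra_simps)
  finally show ?thesis using st by (intro rat_congI[of _ "s * x' + y * t"] p_integral_intros)
qed

lemma rat_cong_sum:
  assumes "\<And>i. i \<in> A \<Longrightarrow> rat_cong p m (f i) (g i)"
  shows "rat_cong p m (sum f A) (sum g A)"
proof -
  have "p_integral p (\<Sum>i\<in>A. (f i - g i) / of_nat p ^ m)"
    using assms by (intro p_integral_sum) (simp add: rat_cong_def)
  moreover have "(\<Sum>i\<in>A. (f i - g i) / of_nat p ^ m) = (sum f A - sum g A) / of_nat p ^ m"
    unfolding sum_subtractf[symmetric] by (rule sum_divide_distrib[symmetric])
  ultimately show ?thesis using assms by (simp add: rat_cong_def p_integral_sum)
qed

text \<open>The bridge to \<open>cong\<close> on \<open>int\<close>: a denominator \<open>d\<close>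
  prime to \<open>p\<close> cancels from \<open>int p ^ m dvd (a - b) * d\<close>. Divisibility
  arguments can thus be carried out with integers.\<close>

lemma rat_cong_of_int_iff:
  "rat_cong p m (of_int a) (of_int b) \<longleftrightarrow> [a = b] (mod int p ^ m)"
proof
  assume "rat_cong p m (of_int a) (of_int b)"
  then obtain z where z: "p_integral p z" "of_int a - of_int b = of_nat p ^ m * z"
    by (elim rat_congE)
  then obtain c d where cd: "\<not> int p dvd d" "z = of_int c / of_int d"
    using p_integral_iff[OF p] by blast
  then have "d \<noteq> 0" by auto
  then have "(of_int ((a - b) * d) :: rat) = of_int (int p ^ m * c)"
    using z cd by (simp add: field_simps)
  then have "(a - b) * d = int p ^ m * c" by (simp only: of_int_eq_iff)
  then have "int p ^ m dvd (a - b) * d" by simp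
  moreover have "coprime (int p ^ m) d"
    using cd p by (simp add: prime_imp_coprime)
  ultimately have "int p ^ m dvd a - b" using coprime_dvd_mult_left_iff by blast
  then show "[a = b] (mod int p ^ m)" by (simp add: cong_iff_dvd_diff)
next
  assume "[a = b] (mod int p ^ m)"
  then obtain c where "a - b = int p ^ m * c" by (auto simp: cong_iff_dvd_diff)
  then have "(of_int a - of_int b :: rat) = of_nat p ^ m * of_int c"
    by (metis of_int_diff of_int_mult of_int_of_nat_eq of_int_power)
  then show "rat_cong p m (of_int a) (of_int b)" by (intro rat_congI[of _ "of_int c"]) simp_all
qed

end

section \<open>The summation identity\<close>

text \<open>For natural \<open>a\<close> this is the coefficient of x^k in the shifted Legendre
  polynomial P_a(1 - 2x). The formula is invariant under a -> -1 - a.\<close>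

definition T :: "nat \<Rightarrow> rat \<Rightarrow> rat" where
  "T k a = (\<Prod>i<k. (of_nat i - a) * (of_nat i + a + 1)) / fact k ^ 2"

text \<open>A partial product of Euler's product for sin(pi a) / (pi a).\<close>

definition R :: "nat \<Rightarrow> rat \<Rightarrow> rat" where
  "R N a = (\<Prod>i=1..N. 1 - a ^ 2 / of_nat i ^ 2)"

lemma T_Suc: "T (Suc k) a = T k a * ((of_nat k - a) * (of_nat k + a + 1) / of_nat (Suc k) ^ 2)"
  by (simp add: T_def power_mult_distrib)

lemma R_Suc: "R (Suc N) a = R N a * (1 - a ^ 2 / of_nat (Suc N) ^ 2)"
  by (simp add: R_def)

text \<open>The factors i - a and i + a with 1 <= i <= N pair up to i^2 - a^2 and form
  \<open>R N a\<close>; the end factors -a and a + N + 1 are left over.\<close>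

lemma T_eq_R: "T (Suc N) a = - a * (a + of_nat (Suc N)) / of_nat (Suc N) ^ 2 * R N a"
proof (induction N)
  case 0
  then show ?case by (simp add: T_def R_def)
next
  case (Suc N)
  then show ?case
    unfolding T_Suc[of "Suc N"] Suc R_Suc
    by (simp add: divide_simps del: of_nat_Suc) (simp add: algebra_simps power2_eq_square)
qed

text \<open>The same pairs occur after the shift; now a and N + 1 - a are left over.\<close>

lemma T_shift_eq_R: "T (Suc N) (a - 1) = a * (of_nat (Suc N) - a) / of_nat (Suc N) ^ 2 * R N a"
proof (induction N)
  case 0
  then show ?case by (simp add: T_def R_def)
next
  case (Suc N)
  then show ?case
    unfolding T_Suc[of "Suc N"] Suc R_Suc
    by (simp add: divide_simps del: of_nat_Suc) (simp add: algebra_simps power2_eq_square)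
qed

text \<open>By induction on \<open>N\<close>: with x = N + 1 and over the common denominator 2x + 1,
  the numerators of the two new terms combine to -2 a^2 (2x + 1) / x^2 times \<open>R N a\<close>.
  The denominator cancels, and the increment of 2 R remains.\<close>

lemma sum_T_recurrence:
  "(2 * a + 1) * (\<Sum>k\<le>N. T k a / of_nat (2 * k + 1))
     - (2 * a - 1) * (\<Sum>k\<le>N. T k (a - 1) / of_nat (2 * k + 1)) = 2 * R N a"
proof (induction N)
  case 0
  then show ?case by (simp add: T_def R_def)
next
  case (Suc N)
  define x :: rat where "x = of_nat (Suc N)"
  have "x \<noteq> 0" "2 * x + 1 \<noteq> 0" "(of_nat (2 * Suc N + 1) :: rat) = 2 * x + 1"
    unfolding x_def by (simp, linarith, simp)
  then have "(2 * a + 1) * (T (Suc N) a / of_nat (2 * Suc N + 1))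
      - (2 * a - 1) * (T (Suc N) (a - 1) / of_nat (2 * Suc N + 1)) = - 2 * a ^ 2 / x ^ 2 * R N a"
    unfolding T_eq_R[of N a] T_shift_eq_R x_def[symmetric]
    by (simp add: divide_simps) (simp add: algebra_simps power2_eq_square)
  then show ?case using Suc
    by (simp add: R_Suc x_def algebra_simps del: of_nat_Suc)
qed

text \<open>The recurrence telescopes down to argument 0, where only the term k = 0
  survives.\<close>

lemma sum_T_of_nat:
  "(2 * of_nat n + 1) * (\<Sum>k\<le>N. T k (of_nat n) / of_nat (2 * k + 1)) = 1 + 2 * (\<Sum>j=1..n. R N (of_nat j))"
proof (induction n)
  case 0
  have "T k 0 = 0" if "k > 0" for k
    using that by (auto simp: T_def)
  moreover have "T 0 0 = 1" by (simp add: T_def)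
  ultimately have "(\<Sum>k\<le>N. T k 0 / of_nat (2 * k + 1)) = (\<Sum>k\<in>{..N}. if k = 0 then 1 else 0)"
    by (intro sum.cong) auto
  then show ?case by simp
next
  case (Suc n)
  then show ?case using sum_T_recurrence[of "of_nat (Suc n)" N]
    by (simp add: algebra_simps)
qed

text \<open>The products of a + i and of a - i over 1 <= i <= N, each divided by N!, are binomial
  coefficients. So \<open>R\<close> is an integer at positive integers, and its divisibility by
  \<open>p\<close> can be studied through binomial coefficients.\<close>

lemma R_of_nat:
  assumes "a > 0"
  shows "R N (of_nat a) = (-1) ^ N * of_nat ((a + N) choose N) * of_nat ((a - 1) choose N)"
proof (induction N)
  case 0
  then show ?case by (simp add: R_def)
next
  case (Suc N)
  define x :: rat where "x = of_nat (Suc N)"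
  have x: "x \<noteq> 0" by (simp add: x_def)
  have 1: "x * of_nat ((a + Suc N) choose Suc N) = (of_nat a + x) * of_nat ((a + N) choose N)"
    using Suc_times_binomial[of N "a + N"] unfolding x_def
    by (metis (mono_tags, lifting) add_Suc_right of_nat_add of_nat_mult)
  \<comment> \<open>Subtraction in \<open>nat\<close> forces the case distinction: for N > a - 1
    both binomial coefficients are 0.\<close>
  have 2: "x * of_nat ((a - 1) choose Suc N) = (of_nat a - x) * of_nat ((a - 1) choose N)"
  proof (cases "N \<le> a - 1")
    case True
    have "Suc N * ((a - 1) choose Suc N) = (a - 1 - N) * ((a - 1) choose N)"
      by (metis binomial_absorb_comp binomial_absorption mult.commute)
    then have "x * of_nat ((a - 1) choose Suc N) = of_nat (a - 1 - N) * of_nat ((a - 1) choose N)"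
      unfolding x_def by (metis of_nat_mult)
    also have "of_nat (a - 1 - N) = of_nat a - x"
      using True assms by (simp add: x_def of_nat_diff algebra_simps)
    finally show ?thesis .
  next
    case False
    then show ?thesis by (simp add: binomial_eq_0)
  qed
  have "R (Suc N) (of_nat a) = R N (of_nat a) * ((x - of_nat a) * (x + of_nat a) / (x * x))"
    using x unfolding R_Suc x_def[symmetric] by (simp add: field_simps power2_eq_square)
  also have "\<dots> = - ((-1) ^ N) * ((of_nat a + x) * of_nat ((a + N) choose N) / x)
      * ((of_nat a - x) * of_nat ((a - 1) choose N) / x)"
    unfolding Suc using x by (simp add: field_simps)
  also have "\<dots> = (-1) ^ Suc N * of_nat ((a + Suc N) choose Suc N) * of_nat ((a - 1) choose Suc N)"
    unfolding 1[symmetric] 2[symmetric] using x by simp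
  finally show ?case .
qed

lemma binomial_prod_eq_fact: "((2 * k) choose k) * ((3 * k) choose k) * fact k ^ 3 = fact (3 * k)"
proof -
  have "fact k * fact (2 * k) * ((3 * k) choose k) = (fact (3 * k) :: nat)"
    using binomial_fact_lemma[of k "3 * k"] by simp
  moreover have "fact k * fact k * ((2 * k) choose k) = (fact (2 * k) :: nat)"
    using binomial_fact_lemma[of k "2 * k"] by simp
  ultimately have "fact k * (fact k * fact k * ((2 * k) choose k)) * ((3 * k) choose k) = (fact (3 * k) :: nat)"
    by simp
  then show ?thesis by (simp only: power3_eq_cube ac_simps)
qed

text \<open>Both values of \<open>w\<close> give the same factors, since -1/3 and -2/3 are exchanged
  by a -> -1 - a. The new factor (k + 1/3)(k + 2/3) / (k + 1)^2 is the ratio of consecutive values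
  of (3k)! / (27^k k!^3).\<close>

lemma T_third:
  assumes "w = 1 \<or> w = 2"
  shows "T k (- (w / 3)) = of_nat ((2 * k) choose k) * of_nat ((3 * k) choose k) / 27 ^ k"
proof -
  have "T k (- (w / 3)) = fact (3 * k) / (27 ^ k * fact k ^ 3)"
  proof (induction k)
    case 0
    then show ?case by (simp add: T_def)
  next
    case (Suc k)
    define x :: rat where "x = of_nat k"
    have x: "x + 1 \<noteq> 0" unfolding x_def by linarith
    have "3 * Suc k = Suc (Suc (Suc (3 * k)))" by simp
    then have "(fact (3 * Suc k) :: rat) = (3 * x + 3) * (3 * x + 2) * (3 * x + 1) * fact (3 * k)"
      by (simp only: fact_Suc of_nat_mult) (simp add: x_def algebra_simps)
    moreover have "(fact (Suc k) :: rat) = (x + 1) * fact k" by (simp add: x_def algebra_simps)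
    moreover have "(of_nat k - - (w / 3)) * (of_nat k + - (w / 3) + 1) = (3 * x + 1) * (3 * x + 2) / 9"
      using assms by (auto simp: x_def field_simps)
    moreover have "(of_nat (Suc k) :: rat) = x + 1" by (simp add: x_def)
    ultimately show ?case unfolding T_Suc Suc
      using x by (simp add: divide_simps power_mult_distrib) (simp add: algebra_simps power2_eq_square power3_eq_cube)
  qed
  moreover have "(of_nat ((2 * k) choose k) * of_nat ((3 * k) choose k) * fact k ^ 3 :: rat) = fact (3 * k)"
    using binomial_prod_eq_fact[of k] by (metis of_nat_fact of_nat_mult of_nat_power)
  moreover have "(fact k :: rat) \<noteq> 0" by simp
  ultimately show ?thesis by (metis (no_types, lifting) mult.commute nonzero_mult_divide_mult_cancel_right power_not_zero)
qed

section \<open>The products \<open>R\<close> modulo \<open>p ^ 3\<close>\<close>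

text \<open>A case of Lucas's theorem, by induction on \<open>v\<close>: in Vandermonde's sum for p
  + M the middle terms contain \<open>p choose k\<close> and vanish modulo p, while the end terms
  give \<open>M choose p\<close> and 1.\<close>

lemma binomial_mod_prime:
  assumes "prime p" "s < p"
  shows "[(p * v + s) choose p = v] (mod p)"
proof (induction v)
  case 0
  then show ?case using assms by (simp add: binomial_eq_0)
next
  case (Suc v)
  define M where "M = p * v + s"
  have p: "p > 0" using assms by simp
  have "(p + M) choose p = (\<Sum>k\<le>p. (p choose k) * (M choose (p - k)))"
    by (simp add: vandermonde)
  also have "{..p} = insert 0 (insert p {1..<p})" using p by auto
  also have "(\<Sum>k\<in>\<dots>. (p choose k) * (M choose (p - k)))
      = (M choose p) + 1 + (\<Sum>k\<in>{1..<p}. (p choose k) * (M choose (p - k)))"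
    using p by simp
  also have "[\<dots> = v + 1 + 0] (mod p)"
  proof (intro cong_add)
    show "[M choose p = v] (mod p)" using Suc by (simp add: M_def)
    have "p dvd (\<Sum>k\<in>{1..<p}. (p choose k) * (M choose (p - k)))"
    proof (intro dvd_sum dvd_mult2)
      fix k assume "k \<in> {1..<p}"
      then show "p dvd p choose k" using assms by (intro dvd_choose_prime) auto
    qed
    then show "[(\<Sum>k\<in>{1..<p}. (p choose k) * (M choose (p - k))) = 0] (mod p)"
      by (simp add: cong_0_iff)
  qed simp
  finally show ?case by (simp add: M_def ac_simps)
qed

text \<open>With M = p v + s, absorption reads p (M choose p) = (p (v - 1) + s + 1) (M choose (p -
  1)). As s + 1 is prime to p, this first forces p to divide the last coefficient. Then its product
  with p (v - 1) vanishes modulo p^2, and \<open>M choose p\<close> is known modulo p.\<close>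

lemma binomial_pred_prime_mod_square:
  assumes "prime p" "s + 1 < p"
  shows "[int (s + 1) * int ((p * v + s) choose (p - 1)) = int (p * v)] (mod int p ^ 2)"
    and "[int ((p * v + s) choose (p - 1)) = 0] (mod int p)"
proof -
  define M where "M = p * v + s"
  define C where "C = int (M choose (p - 1))"
  have p: "p > 0" "prime (int p)" using assms by simp_all
  have "p * (M choose p) = (M - (p - 1)) * (M choose (p - 1))"
    using p by (metis Suc_diff_1 binomial_absorb_comp binomial_absorption)
  then have "int p * int (M choose p) = int (M - (p - 1)) * C"
    by (metis C_def of_nat_mult)
  \<comment> \<open>For M < p - 1 the natural subtraction is truncated, but then \<open>C\<close> is
    0.\<close>
  also have "int (M - (p - 1)) * C = (int M - int p + 1) * C"
  proof (cases "p - 1 \<le> M")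
    case True
    then show ?thesis using p by (simp add: of_nat_diff algebra_simps)
  next
    case False
    then show ?thesis by (simp add: C_def binomial_eq_0)
  qed
  finally have eq: "int p * int (M choose p) = (int p * (int v - 1) + int (s + 1)) * C"
    by (simp add: M_def algebra_simps)
  then have "int p * (int (M choose p) - (int v - 1) * C) = int (s + 1) * C"
    by (simp add: algebra_simps)
  then have "int p dvd int (s + 1) * C" by (metis dvd_triv_left)
  moreover have "\<not> int p dvd int (s + 1)"
    using assms by (auto simp del: of_nat_Suc dest: nat_dvd_not_less)
  ultimately have "int p dvd C" using p prime_dvd_mult_iff by blast
  then show "[int ((p * v + s) choose (p - 1)) = 0] (mod int p)"
    by (simp add: cong_0_iff C_def M_def)
  have "[int (M choose p) = int v] (mod int p)"
    using binomial_mod_prime[of p s v] assms by (simp add: M_def cong_int_iff)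
  with \<open>int p dvd C\<close> have "int p dvd int (M choose p) - int v - (int v - 1) * C"
    by (auto simp: cong_iff_dvd_diff)
  then have "int p * int p dvd int p * (int (M choose p) - int v - (int v - 1) * C)"
    by (rule mult_dvd_mono[OF dvd_refl])
  also have "int p * (int (M choose p) - int v - (int v - 1) * C) = int (s + 1) * C - int (p * v)"
    using eq by (simp add: algebra_simps)
  finally show "[int (s + 1) * int ((p * v + s) choose (p - 1)) = int (p * v)] (mod int p ^ 2)"
    by (simp add: cong_iff_dvd_diff power2_eq_square C_def M_def)
qed

text \<open>Fermat's theorem makes r^(p-3) an integer substitute for 1 / r^2 modulo p.\<close>

lemma fermat_pow_minus_3:
  assumes "prime p" "p > 3" "\<not> p dvd r"
  shows "[int r ^ 2 * int r ^ (p - 3) = 1] (mod int p)"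
proof -
  have "2 + (p - 3) = p - 1" using assms by simp
  moreover have "r ^ 2 * r ^ (p - 3) = r ^ (2 + (p - 3))" by (simp only: power_add)
  ultimately have "[r ^ 2 * r ^ (p - 3) = 1] (mod p)"
    using fermat_theorem[of p r] assms by simp
  then have "[int (r ^ 2 * r ^ (p - 3)) = int 1] (mod int p)" by (simp only: cong_int_iff)
  then show ?thesis by simp
qed

text \<open>By \<open>R_of_nat\<close> the value is a product of two binomial coefficients
  \<open>(p v + (r - 1)) choose (p - 1)\<close>, with \<open>v = u + 1\<close> and \<open>v = u\<close>; each is divisible by \<open>p\<close>.\<close>

lemma R_nondivisible_mod_cube:
  assumes "prime p" "p > 3" "r > 0" "r < p"
  shows "rat_cong p 3 (R (p - 1) (of_nat (p * u + r))) (of_int (int p ^ 2 * (int u * (int u + 1) * int r ^ (p - 3))))"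
proof -
  define a where "a = p * u + r"
  define X Y where "X = int ((p * (u + 1) + (r - 1)) choose (p - 1))"
    and "Y = int ((p * u + (r - 1)) choose (p - 1))"
  have "odd p" using assms prime_odd_nat by auto
  moreover have "a + (p - 1) = p * (u + 1) + (r - 1)" "a - 1 = p * u + (r - 1)"
    using assms by (auto simp: a_def)
  ultimately have R: "R (p - 1) (of_nat a) = of_int (X * Y)"
    using assms R_of_nat[of a "p - 1"] by (simp add: X_def Y_def a_def)
  have r1: "int (r - 1 + 1) = int r" using assms by simp
  note B = binomial_pred_prime_mod_square[of p "r - 1", unfolded r1]
  obtain x where x: "X = int p * x"
    using B(2)[of "u + 1"] assms by (auto simp: cong_0_iff X_def)
  obtain y where y: "Y = int p * y"
    using B(2)[of u] assms by (auto simp: cong_0_iff Y_def)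
  have "int p * int p dvd int p * (int r * x - (int u + 1))"
    using B(1)[of "u + 1"] assms unfolding X_def[symmetric] x
    by (simp add: cong_iff_dvd_diff power2_eq_square algebra_simps)
  then have "[int r * x = int u + 1] (mod int p)"
    using assms by (simp add: cong_iff_dvd_diff)
  moreover have "int p * int p dvd int p * (int r * y - int u)"
    using B(1)[of u] assms unfolding Y_def[symmetric] y
    by (simp add: cong_iff_dvd_diff power2_eq_square algebra_simps)
  then have "[int r * y = int u] (mod int p)"
    using assms by (simp add: cong_iff_dvd_diff)
  ultimately have "[(int r * x) * (int r * y) = (int u + 1) * int u] (mod int p)"
    by (rule cong_mult)
  then have 1: "[int r ^ (p - 3) * ((int r * x) * (int r * y)) = int r ^ (p - 3) * ((int u + 1) * int u)] (mod int p)"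
    by (rule cong_mult[OF cong_refl])
  have 2: "[(int r ^ 2 * int r ^ (p - 3)) * (x * y) = 1 * (x * y)] (mod int p)"
    using assms by (intro cong_mult fermat_pow_minus_3 cong_refl) (auto dest: nat_dvd_not_less)
  have "int r ^ (p - 3) * ((int r * x) * (int r * y)) = (int r ^ 2 * int r ^ (p - 3)) * (x * y)"
    by (simp only: power2_eq_square ac_simps)
  from cong_trans[OF cong_sym[OF 2] 1[unfolded this]]
  have "[x * y = int u * (int u + 1) * int r ^ (p - 3)] (mod int p)" by (simp add: ac_simps)
  then have "int p ^ 2 * int p dvd int p ^ 2 * (x * y - int u * (int u + 1) * int r ^ (p - 3))"
    by (auto simp: cong_iff_dvd_diff)
  then have "[X * Y = int p ^ 2 * (int u * (int u + 1) * int r ^ (p - 3))] (mod int p ^ 3)"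
    unfolding cong_iff_dvd_diff by (simp add: x y power2_eq_square power3_eq_cube algebra_simps)
  then show ?thesis using assms R unfolding a_def by (simp only: rat_cong_of_int_iff)
qed

lemma sum_inverse_squares_mod:
  assumes "prime p" "p > 3" "\<And>i. i \<in> A \<Longrightarrow> \<not> p dvd i"
  shows "rat_cong p 1 (\<Sum>i\<in>A. 1 / of_nat i ^ 2) (of_int (\<Sum>i\<in>A. int i ^ (p - 3)))"
  unfolding of_int_sum
proof (intro rat_cong_sum assms)
  fix i assume "i \<in> A"
  then have i: "\<not> p dvd i" using assms by blast
  then have inv: "p_integral p (1 / of_nat i ^ 2)"
    using p_integral_power[OF assms(1) p_integral_inverse_nat[OF assms(1) i], of 2]
    by (simp add: power_one_over)
  have "i \<noteq> 0" using i dvd_0_right by metis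
  have "rat_cong p 1 (of_int (int i ^ 2 * int i ^ (p - 3))) (of_int 1)"
    unfolding rat_cong_of_int_iff[OF assms(1)] using fermat_pow_minus_3[of p i] assms i by simp
  then have "rat_cong p 1 ((1 / of_nat i ^ 2) * of_int (int i ^ 2 * int i ^ (p - 3))) ((1 / of_nat i ^ 2) * of_int 1)"
    by (rule rat_cong_mult[OF assms(1) rat_cong_refl[OF assms(1) inv]])
  then show "rat_cong p 1 (1 / of_nat i ^ 2) (of_int (int i ^ (p - 3)))"
    using \<open>i \<noteq> 0\<close> rat_cong_sym[OF assms(1)] by simp
qed


section \<open>Power sums modulo p and their symmetries\<close>

lemma sum_atLeast1_add:
  "(\<Sum>j=1..N + m. f j) = (\<Sum>j=1..N. f j) + (\<Sum>r=1..m. f (N + r :: nat) :: 'a :: comm_monoid_add)"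
  by (induction m) (simp_all add: add.assoc)

text \<open>Modulo a prime p > 3 this stands for the sum of 1 / s^2 over the selected s. Selecting
  by a predicate lets substitutions such as s -> p - s act on the argument of
  \<open>P\<close>.\<close>

definition pow_sum :: "nat \<Rightarrow> (nat \<Rightarrow> bool) \<Rightarrow> int" where
  "pow_sum p P = (\<Sum>s | s \<in> {1..<p} \<and> P s. int s ^ (p - 3))"

lemma pow_sum_cong: "(\<And>s. 0 < s \<Longrightarrow> s < p \<Longrightarrow> P s = Q s) \<Longrightarrow> pow_sum p P = pow_sum p Q"
  unfolding pow_sum_def by (intro sum.cong) auto

lemma pow_sum_disj:
  assumes "\<And>s. \<not> (P s \<and> Q s)"
  shows "pow_sum p (\<lambda>s. P s \<or> Q s) = pow_sum p P + pow_sum p Q"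
proof -
  have "{s. s \<in> {1..<p} \<and> (P s \<or> Q s)} = {s. s \<in> {1..<p} \<and> P s} \<union> {s. s \<in> {1..<p} \<and> Q s}"
    by auto
  then show ?thesis using assms unfolding pow_sum_def by (simp, subst sum.union_disjoint) auto
qed

context
  fixes p :: nat
  assumes p: "prime p" and p3: "p > 3"
begin

lemma odd_p: "odd p"
  using p p3 prime_odd_nat by auto

text \<open>The exponent p - 3 is even, so s and p - s have congruent powers.\<close>

lemma pow_sum_reflect: "[pow_sum p P = pow_sum p (\<lambda>s. P (p - s))] (mod int p)"
proof -
  have "pow_sum p P = (\<Sum>s | s \<in> {1..<p} \<and> P (p - s). int (p - s) ^ (p - 3))"
    unfolding pow_sum_def
    by (rule sum.reindex_bij_witness[of _ "\<lambda>s. p - s" "\<lambda>s. p - s"]) auto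
  also have "[\<dots> = pow_sum p (\<lambda>s. P (p - s))] (mod int p)"
    unfolding pow_sum_def
  proof (rule cong_sum)
    fix s assume "s \<in> {s \<in> {1..<p}. P (p - s)}"
    then have "int (p - s) = int p - int s" by auto
    then have "[int (p - s) = - int s] (mod int p)" by (simp add: cong_iff_dvd_diff)
    then have "[int (p - s) ^ (p - 3) = (- int s) ^ (p - 3)] (mod int p)" by (rule cong_pow)
    moreover have "even (p - 3)" using odd_p p3 by simp
    ultimately show "[int (p - s) ^ (p - 3) = int s ^ (p - 3)] (mod int p)" by simp
  qed
  finally show ?thesis .
qed

text \<open>Substituting s = 2t produces the factor 2^(p-3), which 4 cancels modulo p by Fermat's
  theorem.\<close>

lemma four_pow_sum_even:
  "[4 * pow_sum p (\<lambda>s. even s \<and> P s) = pow_sum p (\<lambda>t. 2 * t < p \<and> P (2 * t))] (mod int p)"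
proof -
  have "pow_sum p (\<lambda>s. even s \<and> P s) = (\<Sum>t | t \<in> {1..<p} \<and> (2 * t < p \<and> P (2 * t)). int (2 * t) ^ (p - 3))"
    unfolding pow_sum_def
    by (rule sum.reindex_bij_witness[of _ "\<lambda>t. 2 * t" "\<lambda>s. s div 2"]) (auto elim!: evenE)
  also have "\<dots> = 2 ^ (p - 3) * pow_sum p (\<lambda>t. 2 * t < p \<and> P (2 * t))"
    by (simp add: pow_sum_def power_mult_distrib sum_distrib_left)
  finally have "4 * pow_sum p (\<lambda>s. even s \<and> P s)
      = (int 2 ^ 2 * int 2 ^ (p - 3)) * pow_sum p (\<lambda>t. 2 * t < p \<and> P (2 * t))"
    by simp
  also have "[\<dots> = 1 * pow_sum p (\<lambda>t. 2 * t < p \<and> P (2 * t))] (mod int p)"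
    using p p3 by (intro cong_mult fermat_pow_minus_3 cong_refl) (auto dest: dvd_imp_le)
  finally show ?thesis by simp
qed

text \<open>Split at \<open>p / 2\<close>, reflect the upper half, and double.\<close>

lemma pow_sum_doubling:
  "[pow_sum p P = 4 * pow_sum p (\<lambda>s. even s \<and> P (s div 2)) + 4 * pow_sum p (\<lambda>s. even s \<and> P (p - s div 2))] (mod int p)"
proof -
  have "pow_sum p P = pow_sum p (\<lambda>t. (2 * t < p \<and> P t) \<or> (\<not> 2 * t < p \<and> P t))"
    by (rule pow_sum_cong) auto
  also have "\<dots> = pow_sum p (\<lambda>t. 2 * t < p \<and> P t) + pow_sum p (\<lambda>t. \<not> 2 * t < p \<and> P t)"
    by (rule pow_sum_disj) auto
  finally have split: "pow_sum p P = \<dots>" .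
  have 1: "[pow_sum p P = pow_sum p (\<lambda>t. 2 * t < p \<and> P t) + pow_sum p (\<lambda>t. 2 * t < p \<and> P (p - t))] (mod int p)"
    unfolding split
  proof (rule cong_add[OF cong_refl])
    have "pow_sum p (\<lambda>t. \<not> 2 * (p - t) < p \<and> P (p - t)) = pow_sum p (\<lambda>t. 2 * t < p \<and> P (p - t))"
    proof (rule pow_sum_cong)
      fix s assume "0 < s" "s < p"
      moreover obtain b where "p = 2 * b + 1" using odd_p by (rule oddE)
      ultimately have "\<not> 2 * (p - s) < p \<longleftrightarrow> 2 * s < p" by arith
      then show "(\<not> 2 * (p - s) < p \<and> P (p - s)) = (2 * s < p \<and> P (p - s))" by simp
    qed
    then show "[pow_sum p (\<lambda>t. \<not> 2 * t < p \<and> P t) = pow_sum p (\<lambda>t. 2 * t < p \<and> P (p - t))] (mod int p)"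
      using pow_sum_reflect[of "\<lambda>t. \<not> 2 * t < p \<and> P t"] by simp
  qed
  have 2: "[pow_sum p (\<lambda>t. 2 * t < p \<and> P t) + pow_sum p (\<lambda>t. 2 * t < p \<and> P (p - t))
      = 4 * pow_sum p (\<lambda>s. even s \<and> P (s div 2)) + 4 * pow_sum p (\<lambda>s. even s \<and> P (p - s div 2))] (mod int p)"
    using four_pow_sum_even[of "\<lambda>s. P (s div 2)"] four_pow_sum_even[of "\<lambda>s. P (p - s div 2)"]
    by (intro cong_add) (simp_all add: cong_sym)
  show ?thesis by (rule cong_trans[OF 1 2])
qed

text \<open>Let E be the sum over even s and F the full sum. Reflection exchanges the parities, as p
  is odd, so F = 2E modulo p; doubling gives F = 8E. Hence 6E = 0, and p > 3 does not divide
  6.\<close>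

lemma pow_sum_even_cong_0: "[pow_sum p even = 0] (mod int p)"
  and pow_sum_True_cong_0: "[pow_sum p (\<lambda>_. True) = 0] (mod int p)"
proof -
  have "pow_sum p (\<lambda>_. True) = pow_sum p (\<lambda>s. even s \<or> odd s)"
    by (rule pow_sum_cong) auto
  also have "\<dots> = pow_sum p even + pow_sum p odd" by (rule pow_sum_disj) auto
  also have "[\<dots> = pow_sum p even + pow_sum p even] (mod int p)"
  proof (rule cong_add[OF cong_refl])
    have "pow_sum p (\<lambda>s. odd (p - s)) = pow_sum p even"
      using odd_p by (intro pow_sum_cong) auto
    then show "[pow_sum p odd = pow_sum p even] (mod int p)"
      using pow_sum_reflect[of odd] by simp
  qed
  finally have 1: "[pow_sum p (\<lambda>_. True) = pow_sum p even + pow_sum p even] (mod int p)" .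
  have 2: "[pow_sum p (\<lambda>_. True) = 4 * pow_sum p even + 4 * pow_sum p even] (mod int p)"
    using pow_sum_doubling[of "\<lambda>_. True"] by simp
  then have "[6 * pow_sum p even = 0] (mod int p)"
    using cong_diff[OF 2 1] by (simp add: cong_iff_dvd_diff)
  moreover have "\<not> int p dvd 6"
  proof
    assume "int p dvd 6"
    then have "p dvd 6" by (metis int_dvd_int_iff of_nat_numeral)
    then have "p dvd 2 * 3" by simp
    then have "p dvd 2 \<or> p dvd 3" using p prime_dvd_mult_iff by blast
    then show False using p3 by (auto dest: dvd_imp_le)
  qed
  ultimately show 3: "[pow_sum p even = 0] (mod int p)"
    using p by (simp add: cong_0_iff prime_dvd_mult_iff)
  show "[pow_sum p (\<lambda>_. True) = 0] (mod int p)"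
    using cong_trans[OF 1 cong_add[OF 3 3]] by simp
qed

text \<open>A first order expansion with p-integral remainder. For x = p^2 the remainder term
  carries the factor p^4 and disappears modulo p^3.\<close>

lemma prod_one_plus_expansion:
  assumes "\<And>i. i \<in> A \<Longrightarrow> p_integral p (c i)" "p_integral p x"
  shows "\<exists>z. p_integral p z \<and> (\<Prod>i\<in>A. 1 + x * c i) = 1 + x * (\<Sum>i\<in>A. c i) + x ^ 2 * z"
  using assms(1)
proof (induction A rule: infinite_finite_induct)
  case (insert i A)
  then obtain z where z: "p_integral p z" "(\<Prod>i\<in>A. 1 + x * c i) = 1 + x * (\<Sum>i\<in>A. c i) + x ^ 2 * z"
    by auto
  have "(\<Prod>i\<in>insert i A. 1 + x * c i)
      = 1 + x * (\<Sum>i\<in>insert i A. c i) + x ^ 2 * (z + c i * (\<Sum>i\<in>A. c i) + x * c i * z)"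
    using insert.hyps by (simp add: z(2)) (simp add: algebra_simps power2_eq_square)
  moreover have "p_integral p (z + c i * (\<Sum>i\<in>A. c i) + x * c i * z)"
    using insert.prems assms(2) z(1) by (intro p_integral_intros[OF p]) auto
  ultimately show ?case by blast
qed (use p_integral_0[OF p] in \<open>auto intro!: exI[of _ 0]\<close>)

text \<open>The factors are 1 - p^2 u^2 / i^2. The linear part of their product is -p^2 u^2 times
  the sum of 1 / i^2 over 0 < i < p, and that sum is divisible by p.\<close>

lemma R_multiple_mod_cube: "rat_cong p 3 (R (p - 1) (of_nat (p * u))) 1"
proof -
  define A where "A = {1..<p}"
  define s :: rat where "s = (\<Sum>i\<in>A. 1 / of_nat i ^ 2)"
  have A: "\<not> p dvd i" if "i \<in> A" for i
    using that by (auto simp: A_def dest: dvd_imp_le)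
  have inv: "p_integral p (1 / of_nat i ^ 2)" if "i \<in> A" for i
    using p_integral_power[OF p p_integral_inverse_nat[OF p A[OF that]], of 2]
    by (simp add: power_one_over)
  have 2: "rat_cong p 1 (of_int (\<Sum>i\<in>A. int i ^ (p - 3))) (of_int 0)"
    unfolding rat_cong_of_int_iff[OF p] using pow_sum_True_cong_0
    by (simp add: pow_sum_def A_def atLeastLessThan_def atLeast_def lessThan_def Int_def)
  have 1: "rat_cong p 1 s (of_int (\<Sum>i\<in>A. int i ^ (p - 3)))"
    unfolding s_def by (rule sum_inverse_squares_mod[OF p p3]) (rule A)
  have "rat_cong p 1 s (of_int 0)"
    by (rule rat_cong_trans[OF p 1 2])
  then obtain y where y: "p_integral p y" "s = of_nat p * y"
    using p by (auto elim!: rat_congE)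
  have "\<exists>z. p_integral p z \<and> (\<Prod>i\<in>A. 1 + of_nat p ^ 2 * (- (of_nat u ^ 2) * (1 / of_nat i ^ 2)))
      = 1 + of_nat p ^ 2 * (\<Sum>i\<in>A. - (of_nat u ^ 2) * (1 / of_nat i ^ 2)) + (of_nat p ^ 2) ^ 2 * z"
    by (rule prod_one_plus_expansion) (intro p_integral_intros[OF p] inv; assumption)+
  then obtain z where z: "p_integral p z"
    "(\<Prod>i\<in>A. 1 + of_nat p ^ 2 * (- (of_nat u ^ 2) * (1 / of_nat i ^ 2)))
      = 1 + of_nat p ^ 2 * (\<Sum>i\<in>A. - (of_nat u ^ 2) * (1 / of_nat i ^ 2)) + (of_nat p ^ 2) ^ 2 * z"
    by blast
  have "{1..p - 1} = A" using p3 by (auto simp: A_def)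
  then have "R (p - 1) (of_nat (p * u)) = (\<Prod>i\<in>A. 1 + of_nat p ^ 2 * (- (of_nat u ^ 2) * (1 / of_nat i ^ 2)))"
    by (simp add: R_def power_mult_distrib)
  also note z(2)
  also have "(\<Sum>i\<in>A. - (of_nat u ^ 2) * (1 / of_nat i ^ 2)) = - (of_nat u ^ 2) * s"
    unfolding s_def by (rule sum_distrib_left[symmetric])
  finally have "R (p - 1) (of_nat (p * u)) - 1 = of_nat p ^ 3 * (- (of_nat u ^ 2) * y + of_nat p * z)"
    unfolding y by (simp add: algebra_simps power2_eq_square power3_eq_cube)
  then show ?thesis
    using y z by (intro rat_congI[OF p, of _ "- (of_nat u ^ 2) * y + of_nat p * z"] p_integral_intros[OF p])
qed

section \<open>Sums of \<open>R\<close> modulo p^3\<close>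

lemma sum_R_nondivisible_mod_cube:
  assumes "m < p"
  shows "rat_cong p 3 (\<Sum>r=1..m. R (p - 1) (of_nat (p * u + r)))
    (of_int (int p ^ 2 * (int u * (int u + 1)) * pow_sum p (\<lambda>s. s \<le> m)))"
proof -
  have "{s. s \<in> {1..<p} \<and> s \<le> m} = {1..m}" using assms by auto
  then have "int p ^ 2 * (int u * (int u + 1)) * pow_sum p (\<lambda>s. s \<le> m)
      = (\<Sum>r=1..m. int p ^ 2 * (int u * (int u + 1) * int r ^ (p - 3)))"
    by (simp add: pow_sum_def sum_distrib_left mult.assoc)
  then show ?thesis unfolding of_int_sum
    using assms p p3 by (auto simp only: of_int_sum atLeastAtMost_iff intro!: rat_cong_sum R_nondivisible_mod_cube)
qed

text \<open>Each block of p consecutive arguments contributes 1, from its last element. The other p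
  - 1 values add up to a multiple of p^2 times the full power sum, which is itself divisible by
  p.\<close>

lemma sum_R_multiples_mod_cube: "rat_cong p 3 (\<Sum>j=1..p * q. R (p - 1) (of_nat j)) (of_int (int q))"
proof (induction q)
  case (Suc q)
  have "p * Suc q = Suc (p * q + (p - 1))" using p3 by simp
  then have "(\<Sum>j=1..p * Suc q. R (p - 1) (of_nat j))
      = (\<Sum>j=1..Suc (p * q + (p - 1)). R (p - 1) (of_nat j))" by (rule arg_cong)
  also have "\<dots> = (\<Sum>j=1..p * q + (p - 1). R (p - 1) (of_nat j)) + R (p - 1) (of_nat (p * Suc q))"
    unfolding \<open>p * Suc q = Suc (p * q + (p - 1))\<close> by (subst sum.cl_ivl_Suc) simp
  also have "(\<Sum>j=1..p * q + (p - 1). R (p - 1) (of_nat j))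
      = (\<Sum>j=1..p * q. R (p - 1) (of_nat j)) + (\<Sum>r=1..p - 1. R (p - 1) (of_nat (p * q + r)))"
    by (rule sum_atLeast1_add)
  finally have eq: "(\<Sum>j=1..p * Suc q. R (p - 1) (of_nat j)) = \<dots> + R (p - 1) (of_nat (p * Suc q))" .
  have all: "pow_sum p (\<lambda>s. s \<le> p - 1) = pow_sum p (\<lambda>_. True)"
    by (rule pow_sum_cong) auto
  have "int p dvd pow_sum p (\<lambda>_. True)" using pow_sum_True_cong_0 by (simp add: cong_0_iff)
  then have "int p ^ 2 * int p dvd int p ^ 2 * (int q * (int q + 1)) * pow_sum p (\<lambda>_. True)"
    by (intro mult_dvd_mono) auto
  then have "[int p ^ 2 * (int q * (int q + 1)) * pow_sum p (\<lambda>_. True) = 0] (mod int p ^ 3)"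
    by (simp add: cong_0_iff power2_eq_square power3_eq_cube mult.assoc)
  then have "rat_cong p 3 (of_int (int p ^ 2 * (int q * (int q + 1)) * pow_sum p (\<lambda>s. s \<le> p - 1))) (of_int 0)"
    unfolding rat_cong_of_int_iff[OF p] all .
  then have "rat_cong p 3 (\<Sum>r=1..p - 1. R (p - 1) (of_nat (p * q + r))) (of_int 0)"
    using p3 by (intro rat_cong_trans[OF p sum_R_nondivisible_mod_cube[of "p - 1" q]]) simp_all
  with Suc have "rat_cong p 3 (\<Sum>j=1..p * Suc q. R (p - 1) (of_nat j)) (of_int (int q) + of_int 0 + 1)"
    unfolding eq by (intro rat_cong_add[OF p] R_multiple_mod_cube)
  then show ?case by (simp add: add.commute)
qed (use p in \<open>simp add: rat_cong_refl\<close>)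

lemma sum_R_mod_cube:
  assumes "m < p"
  shows "rat_cong p 3 (\<Sum>j=1..p * q + m. R (p - 1) (of_nat j))
    (of_int (int q + int p ^ 2 * (int q * (int q + 1)) * pow_sum p (\<lambda>s. s \<le> m)))"
  unfolding sum_atLeast1_add of_int_add
  by (intro rat_cong_add[OF p] sum_R_multiples_mod_cube sum_R_nondivisible_mod_cube assms)

end

section \<open>Power sums up to \<open>p / 3\<close> and the numbers \<open>U\<close>\<close>

lemma mod_6_cases: "r = 0 \<or> r = 1 \<or> r = 2 \<or> r = 3 \<or> r = 4 \<or> r = 5" if "r = n mod 6" for n :: nat
proof -
  have "r < 6" using that by simp
  then show ?thesis by (auto simp: eval_nat_numeral less_Suc_eq)
qed

lemma even_iff_mod_6: "even n \<longleftrightarrow> n mod 6 = 0 \<or> n mod 6 = 2 \<or> n mod 6 = 4" for n :: nat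
proof -
  define r where "r = n mod 6"
  have "even n \<longleftrightarrow> even r" unfolding r_def by (rule dvd_mod_iff[symmetric]) simp
  then show ?thesis using mod_6_cases[OF r_def] unfolding r_def[symmetric] by (elim disjE) simp_all
qed

lemma three_dvd_iff_mod_6: "3 dvd n \<longleftrightarrow> n mod 6 = 0 \<or> n mod 6 = 3" for n :: nat
proof -
  define r where "r = n mod 6"
  have "3 dvd n \<longleftrightarrow> 3 dvd r" unfolding r_def by (rule dvd_mod_iff[symmetric]) simp
  then show ?thesis using mod_6_cases[OF r_def] unfolding r_def[symmetric] by (elim disjE) simp_all
qed

lemma mod_3_eq_mod_6_mod_3: "n mod 3 = (n mod 6) mod 3" for n :: nat
  by (rule mod_mod_cancel[symmetric]) simp

section \<open>The numbers \<open>U\<close> and the polynomials \<open>V\<close>\<close>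

lemma U_odd: "odd n \<Longrightarrow> U n = 0"
proof (induction n rule: less_induct)
  case (less n)
  then have "n \<ge> 1" by (auto intro: Suc_leI odd_pos)
  moreover have "U (n - 2 * k) = 0" if "k \<in> {1..n div 2}" for k
    using that less by (intro less.IH) auto
  ultimately show ?case by (simp add: U_rec)
qed

text \<open>In exponential generating functions: that of \<open>U\<close> times e^t - 1 + e^(-t) is
  1. The bracket vanishes for odd l - i and is 2 for even l - i > 0, so for l > 0 this is the
  recurrence of \<open>U\<close>.\<close>

lemma U_convolution:
  "(\<Sum>i\<le>l. int (l choose i) * U i * (1 + (- 1) ^ (l - i) - of_bool (l = i))) = of_bool (l = 0)"
proof (cases "l = 0")
  case False
  have "(\<Sum>i\<le>l. int (l choose i) * U i * (1 + (- 1) ^ (l - i) - of_bool (l = i)))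
      = (\<Sum>i\<in>insert l {..<l}. int (l choose i) * U i * (1 + (- 1) ^ (l - i) - of_bool (l = i)))"
    by (intro sum.cong) auto
  also have "\<dots> = U l + (\<Sum>i<l. int (l choose i) * U i * (1 + (- 1) ^ (l - i)))"
    by simp
  also have "(\<Sum>i<l. int (l choose i) * U i * (1 + (- 1) ^ (l - i)))
      = (\<Sum>i | i < l \<and> even (l - i). int (l choose i) * U i * (1 + (- 1) ^ (l - i)))"
    by (rule sum.mono_neutral_right) auto
  also have "\<dots> = (\<Sum>k = 1..l div 2. 2 * (int (l choose (2 * k)) * U (l - 2 * k)))"
  proof (rule sum.reindex_bij_witness[where i = "\<lambda>k. l - 2 * k" and j = "\<lambda>i. (l - i) div 2"])
    fix i assume i: "i \<in> {i. i < l \<and> even (l - i)}"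
    then have k: "2 * ((l - i) div 2) = l - i" by (intro dvd_mult_div_cancel) blast
    then show "l - 2 * ((l - i) div 2) = i" using i by simp
    show "(l - i) div 2 \<in> {1..l div 2}"
    proof -
      have "l - i > 0" using i by simp
      then have "(l - i) div 2 \<ge> 1" using k by linarith
      moreover have "(l - i) div 2 \<le> l div 2" by (simp add: div_le_mono)
      ultimately show ?thesis by simp
    qed
    show "2 * (int (l choose (2 * ((l - i) div 2))) * U (l - 2 * ((l - i) div 2)))
        = int (l choose i) * U i * (1 + (- 1) ^ (l - i))"
    proof -
      have "(- 1 :: int) ^ (l - i) = 1" using i by (intro neg_one_even_power) blast
      then show ?thesis unfolding k using i binomial_symmetric[of i l] by simp
    qed
  next
    fix k assume "k \<in> {1..l div 2}"
    then have k: "k > 0" "2 * k \<le> l" by auto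
    then show "(l - (l - 2 * k)) div 2 = k" "l - 2 * k \<in> {i. i < l \<and> even (l - i)}" by auto
  qed
  also have "U l + \<dots> = 0" using False by (subst U_rec) (simp_all flip: sum_distrib_left)
  finally show ?thesis using False by simp
qed (simp add: U_0)

definition V :: "nat \<Rightarrow> int \<Rightarrow> int" where
  "V n x = (\<Sum>k\<le>n. int (n choose k) * U k * x ^ (n - k))"

text \<open>The coefficients are those of the second factor in \<open>U_convolution\<close>, so that
  the two expansions can be combined.\<close>

lemma pow_difference:
  "(x + 1) ^ n - x ^ n + (x - 1) ^ n = (\<Sum>i\<le>n. int (n choose i) * (1 + (- 1) ^ i - of_bool (i = 0)) * x ^ (n - i))"
proof -
  have "(x + 1) ^ n = (\<Sum>i\<le>n. int (n choose i) * x ^ (n - i))"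
    using binomial_ring[of 1 x n] by (simp add: add.commute)
  moreover have "(x - 1) ^ n = (\<Sum>i\<le>n. int (n choose i) * (- 1) ^ i * x ^ (n - i))"
    using binomial_ring[of "- 1" x n] by simp
  moreover have "x ^ n = (\<Sum>i\<le>n. int (n choose i) * of_bool (i = 0) * x ^ (n - i))"
  proof -
    have "(\<Sum>i\<le>n. int (n choose i) * of_bool (i = 0) * x ^ (n - i)) = (\<Sum>i\<in>{..n}. if i = 0 then x ^ n else 0)"
      by (intro sum.cong) auto
    then show ?thesis by simp
  qed
  ultimately show ?thesis
    by (simp add: algebra_simps sum.distrib sum_subtractf)
qed

text \<open>After expanding, group by l = k + i: the binomial coefficients become (n choose l)(l
  choose k), the inner sum over k is \<open>U_convolution\<close>, and only l = 0 survives.\<close>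

lemma V_difference: "V n (x + 1) - V n x + V n (x - 1) = x ^ n"
proof -
  define a :: "nat \<Rightarrow> int" where "a i = 1 + (- 1) ^ i - of_bool (i = 0)" for i
  have "V n (x + 1) - V n x + V n (x - 1)
      = (\<Sum>k\<le>n. int (n choose k) * U k * ((x + 1) ^ (n - k) - x ^ (n - k) + (x - 1) ^ (n - k)))"
    by (simp add: V_def distrib_left right_diff_distrib sum.distrib sum_subtractf)
  also have "\<dots> = (\<Sum>k\<le>n. \<Sum>i\<le>n - k. int (n choose k) * U k * (int ((n - k) choose i) * a i * x ^ (n - k - i)))"
    by (simp only: pow_difference a_def sum_distrib_left)
  also have "\<dots> = (\<Sum>(k, i)\<in>{(k, i). k + i \<le> n}. int (n choose k) * U k * (int ((n - k) choose i) * a i * x ^ (n - k - i)))"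
  proof -
    have "{(k, i). k + i \<le> n} = (SIGMA k:{..n}. {..n - k})" by auto
    then show ?thesis by (simp add: sum.Sigma)
  qed
  also have "\<dots> = (\<Sum>l\<le>n. \<Sum>k\<le>l. int (n choose k) * U k * (int ((n - k) choose (l - k)) * a (l - k) * x ^ (n - k - (l - k))))"
    by (rule sum.triangle_reindex_eq)
  also have "\<dots> = (\<Sum>l\<le>n. int (n choose l) * x ^ (n - l) * (\<Sum>k\<le>l. int (l choose k) * U k * a (l - k)))"
    unfolding sum_distrib_left
  proof (intro sum.cong refl)
    fix l k assume "l \<in> {..n}" "k \<in> {..l}"
    then have 1: "int (n choose k) * int ((n - k) choose (l - k)) = int (n choose l) * int (l choose k)"
      using choose_mult[of k l n] by (simp flip: of_nat_mult)
    have 2: "n - k - (l - k) = n - l" using \<open>k \<in> {..l}\<close> by auto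
    have "int (n choose k) * U k * (int ((n - k) choose (l - k)) * a (l - k) * x ^ (n - k - (l - k)))
        = (int (n choose k) * int ((n - k) choose (l - k))) * (U k * a (l - k) * x ^ (n - l))"
      unfolding 2 by (simp only: ac_simps)
    then show "int (n choose k) * U k * (int ((n - k) choose (l - k)) * a (l - k) * x ^ (n - k - (l - k)))
        = int (n choose l) * x ^ (n - l) * (int (l choose k) * U k * a (l - k))"
      unfolding 1 by (simp only: ac_simps)
  qed
  also have "\<dots> = (\<Sum>l\<le>n. int (n choose l) * x ^ (n - l) * of_bool (l = 0))"
  proof (intro sum.cong refl arg_cong2[where f = times])
    fix l :: nat
    have "(\<Sum>k\<le>l. int (l choose k) * U k * a (l - k))
        = (\<Sum>i\<le>l. int (l choose i) * U i * (1 + (- 1) ^ (l - i) - of_bool (l = i)))"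
      by (intro sum.cong) (auto simp: a_def)
    then show "(\<Sum>k\<le>l. int (l choose k) * U k * a (l - k)) = of_bool (l = 0)"
      by (simp only: U_convolution)
  qed
  also have "\<dots> = (\<Sum>l\<in>{..n}. if l = 0 then x ^ n else 0)" by (intro sum.cong) auto
  finally show ?thesis by simp
qed

text \<open>Umbrally, \<open>(z\<^sup>2 - z + 1) (z + 1) (z\<^sup>3 - 1) = z ^ 6 - 1\<close> for the shift \<open>z\<close>.\<close>

lemma V_difference_6: "V n (x + 6) - V n x = (x + 4) ^ n + (x + 5) ^ n - (x + 1) ^ n - (x + 2) ^ n"
proof -
  have diff: "V n c - V n b + V n a = b ^ n" if "c = b + 1" "a = b - 1" for a b c
    unfolding that by (rule V_difference)
  show ?thesis
    using diff[of "x + 2" "x + 1" x] diff[of "x + 3" "x + 2" "x + 1"]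
      diff[of "x + 5" "x + 4" "x + 3"] diff[of "x + 6" "x + 5" "x + 4"] by simp
qed

lemma V_difference_6_mult:
  "V n (x + 6 * int t) - V n x
    = (\<Sum>j<t. (6 * int j + (x + 4)) ^ n) + (\<Sum>j<t. (6 * int j + (x + 5)) ^ n)
      - (\<Sum>j<t. (6 * int j + (x + 1)) ^ n) - (\<Sum>j<t. (6 * int j + (x + 2)) ^ n)"
proof (induction t)
  case (Suc t)
  then show ?case using V_difference_6[of n "x + 6 * int t"] by (simp add: algebra_simps)
qed simp

lemma V_0: "V n 0 = U n"
proof -
  have "V n 0 = (\<Sum>k\<in>{..n}. if k = n then U n else 0)"
    unfolding V_def by (intro sum.cong) auto
  then show ?thesis by simp
qed

lemma V_minus_1: "even n \<Longrightarrow> V n (- 1) = V n 1"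
  unfolding V_def
proof (intro sum.cong refl)
  fix k assume "even n" "k \<in> {..n}"
  then show "int (n choose k) * U k * (- 1) ^ (n - k) = int (n choose k) * U k * 1 ^ (n - k)"
    by (cases "even k") (auto simp: U_odd)
qed

text \<open>At x = 0 the difference equation has right-hand side 0, and its two outer terms agree by
  \<open>V_minus_1\<close>.\<close>

lemma two_V_1: "even n \<Longrightarrow> n > 0 \<Longrightarrow> 2 * V n 1 = U n"
  using V_difference[of n 0] by (simp add: V_0 V_minus_1 zero_power)

lemma V_cong: "[x = y] (mod m) \<Longrightarrow> [V n x = V n y] (mod m)"
  unfolding V_def by (intro cong_sum cong_mult cong_pow cong_refl)

text \<open>For p = 6t + 1 the range 0 < s < p consists of the t blocks 6j + 1, ..., 6j + 6. Hence
  class 0 is represented by c = 6, and 1 is subtracted before dividing by 6.\<close>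

lemma pow_sum_mod_6_eq_1:
  assumes "p = 6 * t + 1" "c mod 6 = i" "0 < c" "c \<le> 6"
  shows "pow_sum p (\<lambda>s. s mod 6 = i) = (\<Sum>j<t. (6 * int j + int c) ^ (p - 3))"
  unfolding pow_sum_def
proof (rule sum.reindex_bij_witness[where i = "\<lambda>j. 6 * j + c" and j = "\<lambda>s. (s - 1) div 6"])
  fix s assume s: "s \<in> {s. s \<in> {1..<p} \<and> s mod 6 = i}"
  then have s': "0 < s" "s < 6 * t + 1" "s mod 6 = c mod 6" using assms by auto
  have "[(s - 1) + 1 = (c - 1) + 1] (mod 6)" using s'(1,3) assms(3) by (simp add: cong_def)
  then have "[s - 1 = c - 1] (mod 6)" by (simp only: cong_add_rcancel_nat)
  then have "(s - 1) mod 6 = c - 1" using assms(3,4) by (simp add: cong_def)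
  then show eq: "6 * ((s - 1) div 6) + c = s"
    using mult_div_mod_eq[of 6 "s - 1"] s'(1) assms(3) by linarith
  show "(s - 1) div 6 \<in> {..<t}" using s' by simp
  have "6 * int ((s - 1) div 6) + int c = int s" using eq by linarith
  then show "(6 * int ((s - 1) div 6) + int c) ^ (p - 3) = int s ^ (p - 3)" by simp
next
  fix j assume j: "j \<in> {..<t}"
  then have "j < t" by simp
  then show "6 * j + c \<in> {s. s \<in> {1..<p} \<and> s mod 6 = i}"
    using assms by simp
  have "6 * j + c - 1 = 6 * j + (c - 1)" using assms(3) by simp
  then show "(6 * j + c - 1) div 6 = j" using assms(4) by simp
qed

text \<open>For p = 6t - 1 the blocks 6j, ..., 6j + 5 with j < t overshoot the range 0 < s < p only
  by 0 and by p itself. The bound i < 5 excludes p, and the summand for 0 vanishes because p - 3 >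
  0.\<close>

lemma pow_sum_mod_6_eq_5:
  assumes "p = 6 * t - 1" "i < 5" "p > 3"
  shows "pow_sum p (\<lambda>s. s mod 6 = i) = (\<Sum>j<t. (6 * int j + int i) ^ (p - 3))"
  unfolding pow_sum_def
proof (rule sum.reindex_bij_witness_not_neutral[where S' = "{}" and T' = "{j. j < t \<and> 6 * j + i = 0}"
      and i = "\<lambda>j. 6 * j + i" and j = "\<lambda>s. s div 6"])
  fix s assume "s \<in> {s. s \<in> {1..<p} \<and> s mod 6 = i}"
  then have s: "0 < s" "s < 6 * t - 1" "s mod 6 = i" using assms(1) by auto
  then have eq: "6 * (s div 6) + i = s" using mult_div_mod_eq[of 6 s] by simp
  then have "6 * int (s div 6) + int i = int s" by linarith
  then show "(6 * int (s div 6) + int i) ^ (p - 3) = int s ^ (p - 3)" by simp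
next
  fix s assume "s \<in> {s. s \<in> {1..<p} \<and> s mod 6 = i} - {}"
  then have s: "0 < s" "s < 6 * t - 1" "s mod 6 = i" using assms(1) by auto
  then show eq: "6 * (s div 6) + i = s" using mult_div_mod_eq[of 6 s] by simp
  have "s div 6 < t" "6 * (s div 6) + i \<noteq> 0" using eq s(1,2) by linarith+
  then show "s div 6 \<in> {..<t} - {j. j < t \<and> 6 * j + i = 0}" by blast
next
  fix j assume j: "j \<in> {..<t} - {j. j < t \<and> 6 * j + i = 0}"
  then have "j < t" "6 * j + i > 0" by auto
  then show "6 * j + i \<in> {s. s \<in> {1..<p} \<and> s mod 6 = i} - {}"
    using assms by auto
  show "(6 * j + i) div 6 = j" using assms by simp
next
  fix j assume "j \<in> {j. j < t \<and> 6 * j + i = 0}"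
  then show "(6 * int j + int i) ^ (p - 3) = 0" using assms(3) by simp
qed auto

section \<open>Relations between the residue classes modulo 6\<close>

context
  fixes p :: nat
  assumes p: "prime p" and p3: "p > 3"
begin

lemma nine_pow_sum_3:
  "[pow_sum p (\<lambda>t. 3 * t < p) = 9 * pow_sum p (\<lambda>s. 3 dvd s)] (mod int p)"
proof -
  have "pow_sum p (\<lambda>s. 3 dvd s) = (\<Sum>t | t \<in> {1..<p} \<and> 3 * t < p. int (3 * t) ^ (p - 3))"
    unfolding pow_sum_def
    by (rule sum.reindex_bij_witness[of _ "\<lambda>t. 3 * t" "\<lambda>s. s div 3"]) auto
  also have "\<dots> = 3 ^ (p - 3) * pow_sum p (\<lambda>t. 3 * t < p)"
    by (simp add: pow_sum_def power_mult_distrib sum_distrib_left)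
  finally have "9 * pow_sum p (\<lambda>s. 3 dvd s) = (int 3 ^ 2 * int 3 ^ (p - 3)) * pow_sum p (\<lambda>t. 3 * t < p)"
    by simp
  also have "[\<dots> = 1 * pow_sum p (\<lambda>t. 3 * t < p)] (mod int p)"
    using p p3 by (intro cong_mult fermat_pow_minus_3 cong_refl) (auto dest: dvd_imp_le)
  finally show ?thesis by (simp add: cong_sym)
qed

text \<open>The even classes give the first relation; the last two are
  \<open>pow_sum_doubling\<close> for the multiples of 3. Together with reflection they leave a
  single free parameter modulo p.\<close>

lemma pow_sum_residue_relations:
  defines "A \<equiv> \<lambda>i. pow_sum p (\<lambda>s. s mod 6 = i)"
  shows "[A 0 + A 2 + A 4 = 0] (mod int p)"
    and "pow_sum p (\<lambda>s. 3 dvd s) = A 0 + A 3"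
    and "p mod 6 = 1 \<Longrightarrow> [A 0 + A 3 = 4 * A 0 + 4 * A 2] (mod int p)"
    and "p mod 6 = 5 \<Longrightarrow> [A 0 + A 3 = 4 * A 0 + 4 * A 4] (mod int p)"
proof -
  have "pow_sum p even = pow_sum p (\<lambda>s. (s mod 6 = 0 \<or> s mod 6 = 2) \<or> s mod 6 = 4)"
    by (rule pow_sum_cong) (simp only: even_iff_mod_6 disj_assoc)
  also have "\<dots> = pow_sum p (\<lambda>s. s mod 6 = 0 \<or> s mod 6 = 2) + A 4"
    unfolding A_def by (rule pow_sum_disj) auto
  also have "pow_sum p (\<lambda>s. s mod 6 = 0 \<or> s mod 6 = 2) = A 0 + A 2"
    unfolding A_def by (rule pow_sum_disj) auto
  finally show "[A 0 + A 2 + A 4 = 0] (mod int p)"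
    using pow_sum_even_cong_0[OF p p3] by simp
  have "pow_sum p (\<lambda>s. 3 dvd s) = pow_sum p (\<lambda>s. s mod 6 = 0 \<or> s mod 6 = 3)"
    by (rule pow_sum_cong) (rule three_dvd_iff_mod_6)
  also have "\<dots> = A 0 + A 3" unfolding A_def by (rule pow_sum_disj) auto
  finally show 1: "pow_sum p (\<lambda>s. 3 dvd s) = A 0 + A 3" .
  \<comment> \<open>For s = 2r, divisibility of p - r by 3 fixes r modulo 3, hence s modulo 6. This
    yields class 2 or 4 according to p modulo 3.\<close>
  have half: "even s \<and> 3 dvd p - s div 2 \<longleftrightarrow> s mod 6 = 2 * (p mod 3)" if "s < p" for s
  proof (cases "even s")
    case True
    then obtain r where r: "s = 2 * r" by blast
    then have "r \<le> p" using that by simp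
    have "3 dvd p - r \<longleftrightarrow> r mod 3 = p mod 3"
      using mod_eq_dvd_iff_nat[OF \<open>r \<le> p\<close>, of 3] by auto
    moreover have "2 * r mod 6 = 2 * (r mod 3)" using mult_mod_right[of 2 r 3] by simp
    ultimately show ?thesis by (simp add: r)
  next
    case False
    then have "odd (s mod 6)" by (simp add: dvd_mod_iff)
    then have "s mod 6 \<noteq> 2 * (p mod 3)" by fastforce
    then show ?thesis using False by simp
  qed
  have 2: "pow_sum p (\<lambda>s. even s \<and> 3 dvd s div 2) = A 0"
    unfolding A_def
  proof (rule pow_sum_cong)
    fix s :: nat
    show "even s \<and> 3 dvd s div 2 \<longleftrightarrow> s mod 6 = 0"
    proof (cases "even s")
      case True
      then obtain r where r: "s = 2 * r" by blast
      have double: "2 * r mod 6 = 2 * (r mod 3)" using mult_mod_right[of 2 r 3] by simp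
      have "3 dvd r \<longleftrightarrow> 2 * r mod 6 = 0"
        unfolding double mult_eq_0_iff mod_eq_0_iff_dvd by simp
      moreover have "2 * r div 2 = r" by simp
      ultimately show ?thesis unfolding r by (simp only: dvd_triv_left simp_thms)
    qed (auto simp: even_iff_mod_6)
  qed
  {
    assume "p mod 6 = 1"
    then have "p mod 3 = 1" by (subst mod_3_eq_mod_6_mod_3) simp
    then have "pow_sum p (\<lambda>s. even s \<and> 3 dvd p - s div 2) = A 2"
      unfolding A_def by (intro pow_sum_cong) (simp add: half)
    with pow_sum_doubling[OF p p3, of "\<lambda>s. 3 dvd s"] 1 2
    show "[A 0 + A 3 = 4 * A 0 + 4 * A 2] (mod int p)" by simp
  next
    assume "p mod 6 = 5"
    then have "p mod 3 = 2" by (subst mod_3_eq_mod_6_mod_3) simp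
    then have "pow_sum p (\<lambda>s. even s \<and> 3 dvd p - s div 2) = A 4"
      unfolding A_def by (intro pow_sum_cong) (simp add: half)
    with pow_sum_doubling[OF p p3, of "\<lambda>s. 3 dvd s"] 1 2
    show "[A 0 + A 3 = 4 * A 0 + 4 * A 4] (mod int p)" by simp
  }
qed

text \<open>Write A i for the sum over class i and u for U (p - 3). In both cases A 0 = -5 A 3
  modulo p, so the sum is 9 (A 0 + A 3) = -36 A 3. Telescoping \<open>V\<close> up to p gives -6 A 3
  = u/2 if p mod 6 = 1 and 6 A 3 = u/2 if p mod 6 = 5.\<close>

lemma pow_sum_third:
  shows "p mod 6 = 1 \<Longrightarrow> [pow_sum p (\<lambda>t. 3 * t < p) = 3 * U (p - 3)] (mod int p)"
    and "p mod 6 = 5 \<Longrightarrow> [pow_sum p (\<lambda>t. 3 * t < p) = - 3 * U (p - 3)] (mod int p)"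
proof -
  define A where "A i = pow_sum p (\<lambda>s. s mod 6 = i)" for i
  define H where "H = pow_sum p (\<lambda>t. 3 * t < p)"
  define u where "u = U (p - 3)"
  note rel = pow_sum_residue_relations[folded A_def]
  have refl: "[A i = A j] (mod int p)" if "i < 6" "j < 6" "p mod 6 = (i + j) mod 6" for i j
  proof -
    have "pow_sum p (\<lambda>s. (p - s) mod 6 = i) = A j"
      unfolding A_def
    proof (rule pow_sum_cong)
      fix s assume "s < p"
      then have sum: "[(p - s) + s = i + j] (mod 6)" using that(3) by (simp add: cong_def)
      have "(p - s) mod 6 = i \<longleftrightarrow> [p - s = i] (mod 6)" using that(1) by (simp add: cong_def)
      also have "\<dots> \<longleftrightarrow> [s = j] (mod 6)"
      proof
        assume "[p - s = i] (mod 6)"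
        from cong_trans[OF cong_add[OF cong_sym[OF this] cong_refl] sum]
        show "[s = j] (mod 6)" by (simp only: cong_add_lcancel_nat)
      next
        assume "[s = j] (mod 6)"
        from cong_trans[OF cong_add[OF cong_refl cong_sym[OF this]] sum]
        show "[p - s = i] (mod 6)" by (simp only: cong_add_rcancel_nat)
      qed
      also have "\<dots> \<longleftrightarrow> s mod 6 = j" using that(2) by (simp add: cong_def)
      finally show "((p - s) mod 6 = i) = (s mod 6 = j)" .
    qed
    then show ?thesis using pow_sum_reflect[OF p p3, of "\<lambda>s. s mod 6 = i"] by (simp add: A_def)
  qed
  have H: "[H = 9 * (A 0 + A 3)] (mod int p)"
    using nine_pow_sum_3 rel(2) by (simp add: H_def)
  have n: "even (p - 3)" "p - 3 > 0" using odd_p[OF p p3] p3 by auto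
  \<comment> \<open>The two ends of the telescoping: \<open>w\<close> is exactly u/2, and
    \<open>v\<close> is congruent to u because p is congruent to 0.\<close>
  define v w where "v = V (p - 3) (int p)" and "w = V (p - 3) 1"
  have V1: "2 * w = u" unfolding w_def u_def by (rule two_V_1[OF n])
  have Vp: "[v = u] (mod int p)"
    using V_cong[of "int p" 0 "int p" "p - 3"] by (simp add: V_0 u_def v_def cong_0_iff)
  {
    assume p1: "p mod 6 = 1"
    define t where "t = p div 6"
    define S where "S c = (\<Sum>j<t. (6 * int j + int c) ^ (p - 3))" for c
    have t: "p = 6 * t + 1" using mult_div_mod_eq[of 6 p] p1 by (simp add: t_def)
    have "v - w = A 5 + A 0 - A 2 - A 3"
    proof -
      have "int p = 1 + 6 * int t" using t by simp
      moreover have "A 5 = S 5" "A 0 = S 6" "A 2 = S 2" "A 3 = S 3"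
        unfolding A_def S_def by (rule pow_sum_mod_6_eq_1[OF t]; simp)+
      ultimately show ?thesis
        using V_difference_6_mult[of "p - 3" 1 t] by (simp add: S_def v_def w_def)
    qed
    \<comment> \<open>The multipliers make all A i cancel against 6 (v - w). Each bracket is a known
      congruence, and an exact identity avoids dividing by 12.\<close>
    with V1 have "H - 3 * u = (H - 9 * (A 0 + A 3)) + 3 * ((A 0 + A 3) - (4 * A 0 + 4 * A 2))
        + 12 * (A 0 + A 2 + A 4) - 12 * (A 4 - A 3) - 6 * (A 5 - A 2) + 6 * (v - u)"
      by (simp add: algebra_simps)
    moreover have "int p dvd \<dots>"
    proof -
      have "[A 5 = A 2] (mod int p)" "[A 4 = A 3] (mod int p)" using p1 by (auto intro: refl)
      note dvds = this[unfolded cong_iff_dvd_diff] Vp[unfolded cong_iff_dvd_diff] H[unfolded cong_iff_dvd_diff]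
        rel(1)[unfolded cong_0_iff] rel(3)[OF p1, unfolded cong_iff_dvd_diff]
      show ?thesis by (intro dvds dvd_add dvd_diff dvd_mult)
    qed
    ultimately have "int p dvd H - 3 * u" by (simp only:)
    then show "[H = 3 * u] (mod int p)" by (simp only: cong_iff_dvd_diff)
  next
    assume p1: "p mod 6 = 5"
    define t where "t = p div 6 + 1"
    define S where "S c = (\<Sum>j<t. (6 * int j + int c) ^ (p - 3))" for c
    have "6 * (p div 6) + 5 = p" using mult_div_mod_eq[of 6 p] p1 by simp
    then have "p + 1 = 6 * t" by (simp add: t_def)
    then have t: "p = 6 * t - 1" "int p = 6 * int t - 1" by linarith+
    \<comment> \<open>Here p = -1 + 6t, so the telescoping starts at -1; the symmetry for even
      exponents then leads back to \<open>w\<close>.\<close>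
    have "v - V (p - 3) (-1) = A 3 + A 4 - A 0 - A 1"
    proof -
      have "int p = - 1 + 6 * int t" using t by simp
      moreover have "A 3 = S 3" "A 4 = S 4" "A 0 = S 0" "A 1 = S 1"
        unfolding A_def S_def by (rule pow_sum_mod_6_eq_5[OF t(1) _ p3]; simp)+
      ultimately show ?thesis
        using V_difference_6_mult[of "p - 3" "- 1" t] by (simp add: S_def v_def w_def)
    qed
    then have "v - w = A 3 + A 4 - A 0 - A 1"
      using V_minus_1 n by (simp add: w_def)
    with V1 have "H - - 3 * u = (H - 9 * (A 0 + A 3)) + 3 * ((A 0 + A 3) - (4 * A 0 + 4 * A 4))
        + 12 * (A 0 + A 2 + A 4) - 12 * (A 2 - A 3) + 6 * (A 4 - A 1) - 6 * (v - u)"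
      by (simp add: algebra_simps)
    moreover have "int p dvd \<dots>"
    proof -
      have "[A 4 = A 1] (mod int p)" "[A 2 = A 3] (mod int p)" using p1 by (auto intro: refl)
      note dvds = this[unfolded cong_iff_dvd_diff] Vp[unfolded cong_iff_dvd_diff] H[unfolded cong_iff_dvd_diff]
        rel(1)[unfolded cong_0_iff] rel(4)[OF p1, unfolded cong_iff_dvd_diff]
      show ?thesis by (intro dvds dvd_add dvd_diff dvd_mult)
    qed
    ultimately have "int p dvd H - - 3 * u" by (simp only:)
    then show "[H = - 3 * u] (mod int p)" by (simp only: cong_iff_dvd_diff)
  }
qed

end

section \<open>Evaluation of the sum\<close>

text \<open>For k < p the denominator k!^2 is prime to p, so \<open>T k\<close> is a polynomial with
  p-integral coefficients.\<close>

lemma T_cong: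
  assumes p: "prime p" and "rat_cong p m x y" "k < p"
  shows "rat_cong p m (T k x) (T k y)"
  using assms(3)
proof (induction k)
  case 0
  then show ?case using p by (simp add: T_def rat_cong_refl)
next
  case (Suc k)
  have "\<not> p dvd Suc k" using Suc.prems by (auto dest: dvd_imp_le)
  then have inv: "p_integral p ((1 / of_nat (Suc k)) ^ 2)"
    by (intro p_integral_power p_integral_inverse_nat p)
  have minus: "rat_cong p m (- x) (- y)"
    using rat_cong_mult[OF p rat_cong_refl[OF p p_integral_of_int[OF p, of "- 1"]] assms(2)] by simp
  have "rat_cong p m
      (T k x * ((of_nat k + - x) * (of_nat k + x + 1) * (1 / of_nat (Suc k)) ^ 2))
      (T k y * ((of_nat k + - y) * (of_nat k + y + 1) * (1 / of_nat (Suc k)) ^ 2))"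
    using Suc p assms(2) minus inv
    by (intro rat_cong_mult rat_cong_add rat_cong_refl) simp_all
  then show ?case by (simp add: T_Suc divide_inverse power_inverse)
qed

lemma Legendre_3:
  "p mod 3 = 1 \<Longrightarrow> Legendre (int p) 3 = 1"
  "p mod 3 = 2 \<Longrightarrow> Legendre (int p) 3 = - 1"
proof -
  assume "p mod 3 = 1"
  then have "int p mod 3 = 1" by (metis of_nat_1 of_nat_mod of_nat_numeral)
  then have "[1 ^ 2 = int p] (mod 3)" "\<not> [int p = 0] (mod 3)" by (simp_all add: cong_def)
  then show "Legendre (int p) 3 = 1" unfolding Legendre_def QuadRes_def by metis
next
  assume "p mod 3 = 2"
  then have p: "int p mod 3 = 2" by (metis of_nat_mod of_nat_numeral)
  have "\<not> [y ^ 2 = int p] (mod 3)" for y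
  proof -
    have "0 \<le> y mod 3" "y mod 3 < 3" by simp_all
    then have "y mod 3 = 0 \<or> y mod 3 = 1 \<or> y mod 3 = 2" by linarith
    then have "(y mod 3) ^ 2 mod 3 \<noteq> 2" by auto
    then show ?thesis using p by (simp add: cong_def power_mod)
  qed
  then show "Legendre (int p) 3 = - 1" using p by (simp add: Legendre_def QuadRes_def cong_def)
qed

text \<open>Modulo P^3 one computes with q = -1/3 and n = -w/3; the factor 9 clears the
  denominators. The key is e = 3 - 2w: the constant terms give 3 - 3 e^2 = 0, and the coefficient of
  P^2 is -12 e u + 12 e u = 0.\<close>

lemma evaluation_mod_cube:
  fixes P :: int
  assumes q: "3 * q = w * P ^ 3 - 1" and n: "3 * n = w * P ^ 4 - w"
    and e: "w = 1 \<and> e = 1 \<or> w = 2 \<and> e = - 1"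
    and h: "[h = 3 * e * u] (mod P)"
  shows "P ^ 3 dvd 9 * (1 + 2 * (q + P ^ 2 * (q * (q + 1)) * h) - (2 * n + 1) * (e - 4 * P ^ 2 * u))"
proof -
  obtain k where "h - 3 * e * u = P * k"
    using h unfolding cong_iff_dvd_diff by (elim dvdE)
  then have k: "h = 3 * e * u + P * k" by simp
  have "9 * (1 + 2 * (q + P ^ 2 * (q * (q + 1)) * h) - (2 * n + 1) * (e - 4 * P ^ 2 * u))
      = 9 + 6 * (3 * q) + 2 * P ^ 2 * ((3 * q) * (3 * q + 3)) * h
        - 3 * (2 * (3 * n) + 3) * (e - 4 * P ^ 2 * u)"
    by (simp add: algebra_simps)
  also have "\<dots> = P ^ 3 * (6 * w - 4 * k + 2 * P ^ 2 * (w ^ 2 * P ^ 3 + w) * (3 * e * u + P * k)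
      - 6 * w * P * (e - 4 * P ^ 2 * u))"
    unfolding q n k using e by (auto simp: algebra_simps power_numeral_reduce)
  finally show ?thesis by simp
qed

theorem theorem3p3:
  fixes p :: nat
  assumes "prime p" and "p > 3"
  shows "rat_cong p 3
    (\<Sum>k = 0..p - 1. of_nat ((2 * k) choose k) * of_nat ((3 * k) choose k)
                       / (27 ^ k * of_nat (2 * k + 1)))
    (of_int (Legendre (int p) 3) - 4 * of_nat p ^ 2 * of_int (U (p - 3)))"
proof -
  note p = assms(1) and p3 = assms(2)
  define w e where "w = p mod 3" and "e = Legendre (int p) 3"
  define m where "m = p div 3"
  have ndvd3: "\<not> p dvd 3" using p3 by (auto dest: dvd_imp_le)
  have "p mod 3 \<noteq> 0"
  proof
    assume "p mod 3 = 0"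
    then have "3 dvd p" by (rule mod_0_imp_dvd)
    then have "p = 3" using p primes_dvd_imp_eq[of 3 p] by simp
    with p3 show False by simp
  qed
  then have w: "w = 1 \<and> e = 1 \<or> w = 2 \<and> e = - 1"
  proof -
    have "p mod 3 < 3" by simp
    with \<open>p mod 3 \<noteq> 0\<close> have "p mod 3 = 1 \<or> p mod 3 = 2" by linarith
    then show ?thesis using Legendre_3[of p] unfolding w_def e_def by auto
  qed
  have pm: "p = 3 * m + w" by (simp add: m_def w_def)
  have "m < p" using p3 by (simp add: m_def)
  \<comment> \<open>As p = w and w^4 = 1 modulo 3, the quotient (w p^3 - 1) / 3 is an integer. It
    serves as \<open>q\<close>, which makes 3n + w exactly w p^4.\<close>
  have "3 dvd int w * int p ^ 3 - 1"
  proof -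
    have "[int p = int w] (mod 3)" by (simp add: pm cong_iff_dvd_diff)
    then have "[int w * int p ^ 3 = int w * int w ^ 3] (mod 3)"
      by (intro cong_mult cong_pow cong_refl)
    also have "[int w * int w ^ 3 = 1] (mod 3)" using w by (auto simp: cong_def)
    finally show ?thesis by (simp add: cong_iff_dvd_diff)
  qed
  then obtain q' where q': "int w * int p ^ 3 - 1 = 3 * q'" by blast
  have "int w * int p ^ 3 > 0" using w p3 by auto
  then have "q' \<ge> 0" using q' by linarith
  then obtain q where q: "3 * int q = int w * int p ^ 3 - 1"
    using q' by (metis nonneg_int_cases)
  define n where "n = p * q + m"
  have "3 * int n = int p * (3 * int q) + 3 * int m" by (simp add: n_def algebra_simps)
  also have "\<dots> = int p * (int w * int p ^ 3 - 1) + (int p - int w)"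
    unfolding q using pm by simp
  finally have n: "3 * int n = int w * int p ^ 4 - int w"
    by (simp add: algebra_simps power_numeral_reduce)

  define x :: rat where "x = - (of_nat w / 3)"
  define S where "S y = (\<Sum>k\<le>p - 1. T k y / of_nat (2 * k + 1))" for y
  define E where "E = e - 4 * int p ^ 2 * U (p - 3)"
  have lhs: "(\<Sum>k = 0..p - 1. of_nat ((2 * k) choose k) * of_nat ((3 * k) choose k)
      / (27 ^ k * of_nat (2 * k + 1))) = S x"
    unfolding S_def
  proof (intro sum.cong)
    fix k assume "k \<in> {..p - 1}"
    have "T k x = of_nat ((2 * k) choose k) * of_nat ((3 * k) choose k) / 27 ^ k"
      unfolding x_def using w by (intro T_third) auto
    then show "of_nat ((2 * k) choose k) * of_nat ((3 * k) choose k) / (27 ^ k * of_nat (2 * k + 1))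
        = T k x / of_nat (2 * k + 1)" by simp
  qed auto

  have w3: "p_integral p (of_nat w / 3)"
    using p_integral_mult[OF p p_integral_of_nat[OF p, of w] p_integral_inverse_nat[OF p ndvd3]] by simp
  have "(of_int (3 * int n) :: rat) = of_int (int w * int p ^ 4 - int w)" by (simp only: n)
  then have "x - of_nat n = of_nat p ^ 4 * - (of_nat w / 3)"
    by (simp add: x_def field_simps)
  then have xn: "rat_cong p 4 x (of_nat n)"
    by (rule rat_congI[OF p p_integral_of_nat[OF p] p_integral_minus[OF p w3]])

  have "\<exists>z. p_integral p z \<and> S x - S (of_nat n) = of_nat p ^ 3 * z"
  proof (intro exI conjI)
    define z where "z k = (T k x - T k (of_nat n)) / of_nat p ^ 4" for k
    show "p_integral p (\<Sum>k\<le>p - 1. z k * (of_nat p / of_nat (2 * k + 1)))"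
    proof (intro p_integral_sum p_integral_mult p)
      fix k assume "k \<in> {..p - 1}"
      then have k: "k < p" using p3 by auto
      show "p_integral p (z k)"
        using T_cong[OF p xn k] by (simp add: z_def rat_cong_def)
      \<comment> \<open>Since 2k + 1 < 2p, the only multiple of p among these denominators is p
        itself, so a single factor p suffices.\<close>
      show "p_integral p (of_nat p / of_nat (2 * k + 1))"
      proof (cases "p dvd 2 * k + 1")
        case True
        then obtain c where c: "2 * k + 1 = p * c" by blast
        have "p * c < p * 2" using c k by linarith
        then have "c = 1" using c by (cases c) auto
        then show ?thesis using c p by (simp del: of_nat_Suc of_nat_add of_nat_mult)
      next
        case False
        then show ?thesis
          using p_integral_mult[OF p p_integral_of_nat[OF p, of p] p_integral_inverse_nat[OF p False]]
          by simp
      qed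
    qed
    have "S x - S (of_nat n) = (\<Sum>k\<le>p - 1. (T k x - T k (of_nat n)) / of_nat (2 * k + 1))"
      unfolding S_def by (simp add: sum_subtractf diff_divide_distrib)
    also have "\<dots> = (\<Sum>k\<le>p - 1. of_nat p ^ 3 * (z k * (of_nat p / of_nat (2 * k + 1))))"
      using p by (intro sum.cong) (simp_all add: z_def power_numeral_reduce)
    finally show "S x - S (of_nat n) = of_nat p ^ 3 * (\<Sum>k\<le>p - 1. z k * (of_nat p / of_nat (2 * k + 1)))"
      by (simp only: sum_distrib_left)
  qed
  then obtain z where z: "p_integral p z" "S x - S (of_nat n) = of_nat p ^ 3 * z" by blast

  define h where "h = pow_sum p (\<lambda>s. s \<le> m)"
  define I where "I = 1 + 2 * (int q + int p ^ 2 * (int q * (int q + 1)) * h) - (2 * int n + 1) * E"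
  \<comment> \<open>As 3 does not divide p, the bound s <= p div 3 is the same as 3s < p.\<close>
  have "h = pow_sum p (\<lambda>t. 3 * t < p)"
    unfolding h_def using w by (intro pow_sum_cong) (auto simp: pm)
  moreover have "p mod 6 = 1 \<and> e = 1 \<or> p mod 6 = 5 \<and> e = - 1"
  proof -
    have "p mod 6 = 1 \<and> p mod 3 = 1 \<or> p mod 6 = 5 \<and> p mod 3 = 2"
      using mod_6_cases[of "p mod 6" p] odd_p[OF p p3] \<open>p mod 3 \<noteq> 0\<close> mod_3_eq_mod_6_mod_3[of p]
      unfolding even_iff_mod_6 by auto
    then show ?thesis using w unfolding w_def by auto
  qed
  ultimately have "[h = 3 * e * U (p - 3)] (mod int p)"
    using pow_sum_third[OF p p3] by auto
  then have "int p ^ 3 dvd 9 * I"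
    unfolding I_def E_def using w by (intro evaluation_mod_cube[OF q n]) auto
  moreover have "coprime (int p ^ 3) 9"
  proof -
    have "coprime p (3 ^ 2)" using p ndvd3 by (simp add: prime_imp_coprime del: power_numeral)
    then have "coprime (int p) (int (3 ^ 2))" by (simp only: coprime_int_iff)
    then show ?thesis by simp
  qed
  ultimately have "int p ^ 3 dvd I" using coprime_dvd_mult_right_iff by blast
  then obtain i where i: "I = int p ^ 3 * i" by blast
  obtain r where r: "p_integral p r"
    "(\<Sum>j=1..n. R (p - 1) (of_nat j)) - of_int (int q + int p ^ 2 * (int q * (int q + 1)) * h) = of_nat p ^ 3 * r"
    using sum_R_mod_cube[OF p p3 \<open>m < p\<close>, of q] unfolding n_def h_def by (elim rat_congE[OF p])
  \<comment> \<open>Modulo p, 3d is 3 - 2w, that is 1 or -1, so the factor 2n + 1 from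
    \<open>sum_T_of_nat\<close> can be divided out.\<close>
  define d where "d = 2 * int n + 1"
  have "\<not> int p dvd d"
  proof
    assume "int p dvd d"
    moreover have "3 * d = 2 * int w * int p ^ 4 - (2 * int w - 3)"
      using n by (simp add: d_def)
    moreover have "int p dvd 2 * int w * int p ^ 4" by simp
    ultimately have "int p dvd 2 * int w - 3" by (metis dvd_diff_right_iff dvd_mult)
    then have "int p dvd 1" using w by auto
    then show False using p3 by simp
  qed
  then have dinv: "p_integral p (1 / of_int d)" "of_int d \<noteq> (0 :: rat)"
    using p_integral_inverse_int[OF p] by auto
  have "of_int d * (S (of_nat n) - of_int E)
      = 1 + 2 * (\<Sum>j=1..n. R (p - 1) (of_nat j)) - of_int d * of_int E"
    using sum_T_of_nat[of n "p - 1"] by (simp add: S_def d_def right_diff_distrib)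
  also have "\<dots> = of_int I + 2 * of_nat p ^ 3 * r"
    using r(2) by (simp add: I_def d_def algebra_simps)
  also have "\<dots> = of_nat p ^ 3 * (of_int i + 2 * r)"
    unfolding i by (simp add: algebra_simps)
  finally have "S (of_nat n) - of_int E = of_nat p ^ 3 * ((of_int i + 2 * r) * (1 / of_int d))"
    using dinv(2) by (simp add: field_simps)
  then have "S x - of_int E = of_nat p ^ 3 * (z + (of_int i + of_int 2 * r) * (1 / of_int d))"
    using z(2) by (simp add: distrib_left)
  moreover have "p_integral p (z + (of_int i + of_int 2 * r) * (1 / of_int d))"
    by (intro p_integral_intros[OF p] z(1) r(1) dinv(1))
  ultimately have "rat_cong p 3 (S x) (of_int E)"
    by (intro rat_congI[OF p p_integral_of_int[OF p]])
  then show ?thesis unfolding lhs by (simp add: E_def e_def)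
qed

end
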